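(* Let $n\ge 2$, let $X_1=\dots=X_n=\mathbb{R}$, $X=\mathbb{R}^n$, and let $\mu_1,\dots,\mu_n$ be Borel probability measures on $\mathbb{R}$, each with finite first moment. Let $$W=\left\{\sum_{k=1}^{n-1}\rho_k(x_1,\dots,x_k)(x_{k+1}-x_k)\ :\ \rho_k\in C_b(\mathbb{R}^k),\ k=1,\dots,n-1\right\}.$$ Then $\Pi_W(\mu_1,\dots,\mu_n)$ equals the set of all $\pi\in\Pi(\mu_1,\dots,\mu_n)$ such that for every $k\in\{1,\dots,n-1\}$ $$\int_{\mathbb{R}}x_{k+1}\,d\pi_{x_1,\dots,x_k}(x_{k+1})=x_k\quad\text{for } (P_{1,\dots,k})_\#\pi\text{-almost all }(x_1,\dots,x_k).$$
   Context: $\Pi(\mu_1,\dots,\mu_n)$ is the set of Borel probability measures on $\mathbb{R}^n$ with marginals $\mu_1,\dots,\mu_n$, and $\Pi_W(\mu_1,\dots,\mu_n)=\{\pi\in\Pi(\mu_1,\dots,\mu_n):\int w\,d\pi=0\ \text{for all } w\in W\}$. $C_b$ denotes bounded continuous real-valued functions. $P_{1,\dots,k}:\mathbb{R}^n\to\mathbb{R}^k$ is the projection on the first $k$ coordinates, and $\pi_{x_1,\dots,x_k}$ denotes the conditional distribution (regular conditional probability) under $\pi$ of the coordinate $x_{k+1}$ given the first $k$ coordinates $(x_1,\dots,x_k)$. *)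

theory Defs
  imports "HOL-Probability.Probability"
begin

text \<open>
  Points of $R^k$ are the functions in \<^term>\<open>{1..k} \<rightarrow>\<^sub>E (UNIV :: real set)\<close>, with coordinates indexed
  from 1.  As the real line is second countable, the product sigma-algebra below is the Borel
  sigma-algebra of $R^k$.
\<close>

abbreviation borel_Rn :: "nat \<Rightarrow> (nat \<Rightarrow> real) measure"
  where "borel_Rn k \<equiv> Pi\<^sub>M {1..k} (\<lambda>_. borel)"

abbreviation top_Rn :: "nat \<Rightarrow> (nat \<Rightarrow> real) topology"
  where "top_Rn k \<equiv> product_topology (\<lambda>_. euclidean) {1..k}"

definition proj_first :: "nat \<Rightarrow> (nat \<Rightarrow> real) \<Rightarrow> (nat \<Rightarrow> real)"
  where "proj_first k x = restrict x {1..k}"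

definition bounded_continuous :: "nat \<Rightarrow> ((nat \<Rightarrow> real) \<Rightarrow> real) set"
  where "bounded_continuous k =
    {\<rho>. continuous_map (top_Rn k) euclidean \<rho> \<and> bounded (\<rho> ` topspace (top_Rn k))}"

definition couplings :: "nat \<Rightarrow> (nat \<Rightarrow> real measure) \<Rightarrow> (nat \<Rightarrow> real) measure set"
  where "couplings n \<mu> =
    {\<pi>. sets \<pi> = sets (borel_Rn n) \<and> prob_space \<pi> \<and>
         (\<forall>i\<in>{1..n}. distr \<pi> borel (\<lambda>x. x i) = \<mu> i)}"

text \<open>
  \<^const>\<open>has_bochner_integral\<close> rather than an equation for \<^const>\<open>lebesgue_integral\<close>, so that a
  non-integrable function does not count as having integral 0.
\<close>

definition constrained_couplings ::
    "((nat \<Rightarrow> real) \<Rightarrow> real) set \<Rightarrow> nat \<Rightarrow> (nat \<Rightarrow> real measure) \<Rightarrow> (nat \<Rightarrow> real) measure set"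
  where "constrained_couplings W n \<mu> =
    {\<pi> \<in> couplings n \<mu>. \<forall>w\<in>W. has_bochner_integral \<pi> w 0}"

definition martingale_tests :: "nat \<Rightarrow> ((nat \<Rightarrow> real) \<Rightarrow> real) set"
  where "martingale_tests n =
    {(\<lambda>x. \<Sum>k\<in>{1..<n}. \<rho> k (proj_first k x) * (x (k + 1) - x k)) | \<rho>.
       \<forall>k\<in>{1..<n}. \<rho> k \<in> bounded_continuous k}"

definition is_cond_distr ::
    "(nat \<Rightarrow> real) measure \<Rightarrow> nat \<Rightarrow> ((nat \<Rightarrow> real) \<Rightarrow> real measure) \<Rightarrow> bool"
  where "is_cond_distr \<pi> k K \<longleftrightarrow>
    K \<in> borel_Rn k \<rightarrow>\<^sub>M prob_algebra borel \<and>
    (\<forall>A\<in>sets (borel_Rn k). \<forall>B\<in>sets borel.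
       emeasure \<pi> {x \<in> space \<pi>. proj_first k x \<in> A \<and> x (k + 1) \<in> B} =
       (\<integral>\<^sup>+y\<in>A. emeasure (K y) B \<partial>distr \<pi> (borel_Rn k) (proj_first k)))"

text \<open>
  A regular conditional distribution exists because the real line is Polish, and it is unique up to
  a null set of conditioning points; the choice below fixes one version.
\<close>

definition cond_distr :: "(nat \<Rightarrow> real) measure \<Rightarrow> nat \<Rightarrow> (nat \<Rightarrow> real) \<Rightarrow> real measure"
  where "cond_distr \<pi> k = (SOME K. is_cond_distr \<pi> k K)"

end

theory Submission
  imports Defs "HOL-Real_Asymp.Real_Asymp"
begin

text \<open>
  Fix $k$, let $Y = (x_1,\dots,x_k)$, $D = x_{k+1} - x_k$, and let $\nu_+$ and $\nu_-$ be the images under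
  $Y$ of the finite measures $D^+ \pi$ and $D^- \pi$.  The test condition for $k$ says that $\nu_+$ and
  $\nu_-$ have the same integrals of bounded continuous functions, i.e. that $\nu_+ = \nu_-$.  On the
  other hand, disintegrating $\pi$ along $Y$, the measures $\nu_+$ and $\nu_-$ have the densities
  $y \mapsto \int (t - y_k)^+ d\pi_y(t)$ and $y \mapsto \int (t - y_k)^- d\pi_y(t)$ with respect to the law
  of $Y$; they coincide iff these (almost everywhere finite) densities coincide almost everywhere,
  which is the martingale condition.  The conditional distributions are constructed from
  Radon-Nikodym densities $H_t$ of the events $x_{k+1} \le t$, whose infima over rational $q > t$
  form a right-continuous distribution function.
\<close>

section \<open>Almost everywhere comparison of functions through their integrals\<close>

text \<open>Infinite values rule out subtracting \<open>g\<close> from \<open>f\<close>. The claim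
  is recast as \<open>max f g = g\<close> almost everywhere, an equality accessible to uniqueness of
  densities. On the part \<open>B\<close> of \<open>A\<close> where \<open>g < f\<close> the maximum
  is \<open>f\<close>, and the hypothesis for \<open>B\<close> bounds its integral by that of
  \<open>g\<close>; on the rest of \<open>A\<close> the maximum is \<open>g\<close>.\<close>

lemma (in sigma_finite_measure) AE_le_if_set_nn_integral_le:
  assumes [measurable]: "f \<in> borel_measurable M" "g \<in> borel_measurable M"
    and le: "\<And>A. A \<in> sets M \<Longrightarrow> (\<integral>\<^sup>+x\<in>A. f x \<partial>M) \<le> (\<integral>\<^sup>+x\<in>A. g x \<partial>M)"
  shows "AE x in M. f x \<le> g x"
proof -
  have "AE x in M. max (f x) (g x) = g x"
  proof (rule density_unique2)
    fix A assume [measurable]: "A \<in> sets M"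
    define B where "B = {x\<in>A. g x < f x}"
    have "B = A \<inter> {x\<in>space M. g x < f x}"
      using sets.sets_into_space[of A M] \<open>A \<in> sets M\<close> by (auto simp: B_def)
    then have B[measurable]: "B \<in> sets M" by simp
    have split: "(\<integral>\<^sup>+x\<in>A. h x \<partial>M) = (\<integral>\<^sup>+x\<in>B. h x \<partial>M) + (\<integral>\<^sup>+x\<in>A - B. h x \<partial>M)"
      if [measurable]: "h \<in> borel_measurable M" for h
      by (subst nn_integral_add[symmetric])
         (auto simp: B_def intro!: nn_integral_cong split: split_indicator)
    have "(\<integral>\<^sup>+x\<in>A. max (f x) (g x) \<partial>M) = (\<integral>\<^sup>+x\<in>B. max (f x) (g x) \<partial>M) + (\<integral>\<^sup>+x\<in>A - B. max (f x) (g x) \<partial>M)"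
      by (rule split) simp
    also have "(\<integral>\<^sup>+x\<in>B. max (f x) (g x) \<partial>M) = (\<integral>\<^sup>+x\<in>B. f x \<partial>M)"
      by (intro nn_integral_cong) (auto simp: B_def max_def split: split_indicator)
    also have "(\<integral>\<^sup>+x\<in>A - B. max (f x) (g x) \<partial>M) = (\<integral>\<^sup>+x\<in>A - B. g x \<partial>M)"
      by (intro nn_integral_cong) (auto simp: B_def max_def split: split_indicator)
    also have "(\<integral>\<^sup>+x\<in>B. f x \<partial>M) + (\<integral>\<^sup>+x\<in>A - B. g x \<partial>M) \<le> (\<integral>\<^sup>+x\<in>A. g x \<partial>M)"
      using le[OF B] by (subst split[of g]) (auto intro!: add_mono)
    finally show "(\<integral>\<^sup>+x\<in>A. max (f x) (g x) \<partial>M) = (\<integral>\<^sup>+x\<in>A. g x \<partial>M)"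
      by (rule antisym) (auto intro!: nn_integral_mono split: split_indicator)
  qed auto
  then show ?thesis
    by eventually_elim (auto simp: max_def split: if_splits)
qed

text \<open>In the construction of conditional distributions this removes three possible defects: a
  gap between the regularised and the original densities, and wrong limits at plus and minus
  infinity. The sequence \<open>u\<close> always comes from the unconditional distribution function
  of \<open>X\<close>.\<close>

lemma AE_zero_if_integral_le_null_sequence:
  fixes f :: "'a \<Rightarrow> real"
  assumes "integrable M f" "AE x in M. 0 \<le> f x"
    and "\<And>n. integral\<^sup>L M f \<le> u n" "u \<longlonglongrightarrow> 0"
  shows "AE x in M. f x = 0"
proof -
  have "integral\<^sup>L M f \<le> 0"
    using assms(3,4) by (intro LIMSEQ_le_const) auto
  moreover have "integral\<^sup>L M f \<ge> 0"
    using assms(2) by (rule integral_nonneg_AE)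
  ultimately show ?thesis
    using integral_nonneg_eq_0_iff_AE[OF assms(1,2)] by simp
qed

section \<open>Half-lines and distribution functions on the real line\<close>

lemma prob_kernel_measurable_if_Iic:
  fixes K :: "'a \<Rightarrow> real measure"
  assumes "\<And>y. y \<in> space N \<Longrightarrow> prob_space (K y)" "\<And>y. y \<in> space N \<Longrightarrow> sets (K y) = sets borel"
    and "\<And>t. (\<lambda>y. emeasure (K y) {..t}) \<in> borel_measurable N"
  shows "K \<in> N \<rightarrow>\<^sub>M prob_algebra borel"
proof (rule measurable_prob_algebra_generated[where \<Omega>=UNIV and G="range atMost"])
  show "sets borel = sigma_sets UNIV (range (atMost :: real \<Rightarrow> _))"
    by (subst borel_eq_atMost) simp
  show "Int_stable (range (atMost :: real \<Rightarrow> _))"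
    by (auto simp: Int_stable_def)
qed (use assms in auto)

lemma measure_eqI_Iic:
  fixes P Q :: "real measure"
  assumes "sets P = sets borel" "sets Q = sets borel"
    and "\<And>t. emeasure P {..t} = emeasure Q {..t}" "emeasure P UNIV \<noteq> \<infinity>"
  shows "P = Q"
proof (rule measure_eqI_generator_eq[where \<Omega>=UNIV and E="range atMost" and A="\<lambda>n. {..real n}"])
  have "sets borel = sigma_sets UNIV (range (atMost :: real \<Rightarrow> _))"
    by (subst borel_eq_atMost) simp
  then show "sets P = sigma_sets UNIV (range atMost)" "sets Q = sigma_sets UNIV (range atMost)"
    using assms by auto
  show "Int_stable (range (atMost :: real \<Rightarrow> _))"
    by (auto simp: Int_stable_def)
  show "emeasure P {..real n} \<noteq> \<infinity>" for n
  proof -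
    have "emeasure P {..real n} \<le> emeasure P UNIV"
      using assms(1) by (intro emeasure_mono) auto
    then show ?thesis
      using assms(4) by (auto simp: top_unique)
  qed
  show "(\<Union>i. {..real i}) = UNIV"
    using real_arch_simple by auto
qed (use assms in auto)

text \<open>The index set shrinks as \<open>t\<close> grows, so \<open>g\<close> is monotone. If
  \<open>g t < a\<close>, a single rational \<open>q > t\<close> witnesses it, and the same
  \<open>q\<close> works for all points between \<open>t\<close> and \<open>q\<close>, which gives
  right-continuity. As \<open>h\<close> is any function into [0, 1], the result applies at every
  conditioning point, and the countable infimum preserves measurability.\<close>

lemma distribution_function_Inf_rat:
  fixes g h :: "real \<Rightarrow> real"
  assumes h: "\<And>q. 0 \<le> h q" "\<And>q. h q \<le> 1"
    and g: "\<And>t. g t = (INF q\<in>{q::rat. t < of_rat q}. h (of_rat q))"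
  shows "\<And>t q. t < of_rat q \<Longrightarrow> g t \<le> h (of_rat q)"
    and "\<And>t c. (\<And>q. t < of_rat q \<Longrightarrow> c \<le> h (of_rat q)) \<Longrightarrow> c \<le> g t"
    and "\<And>t. 0 \<le> g t" "\<And>t. g t \<le> 1" "mono g" "\<And>t. continuous (at_right t) g"
proof -
  have ne: "{q::rat. t < of_rat q} \<noteq> {}" for t :: real
    using of_rat_dense[of t "t + 1"] by auto
  have bdd: "bdd_below ((\<lambda>q. h (of_rat q)) ` {q::rat. t < of_rat q})" for t :: real
    using h(1) by (intro bdd_belowI2[of _ 0]) auto
  show upper: "g t \<le> h (of_rat q)" if "t < of_rat q" for t q
    unfolding g using that by (intro cINF_lower[OF bdd]) simp
  show lower: "c \<le> g t" if "\<And>q. t < of_rat q \<Longrightarrow> c \<le> h (of_rat q)" for t c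
    unfolding g using that by (intro cINF_greatest ne) auto
  show "0 \<le> g t" for t
    using h(1) by (intro lower) auto
  show "g t \<le> 1" for t
    using ne[of t] upper h(2) order_trans by blast
  show mono: "mono g"
    by (intro monoI lower upper) auto
  show "continuous (at_right t) g" for t
    unfolding continuous_within
  proof (rule order_tendstoI)
    fix a assume "a < g t"
    then show "\<forall>\<^sub>F s in at_right t. a < g s"
      using monoD[OF mono] by (auto simp: eventually_at_filter intro!: always_eventually less_le_trans[of a "g t"])
  next
    fix a assume "g t < a"
    then obtain q where q: "t < of_rat q" "h (of_rat q) < a"
      using lower[of t a] by (meson not_le)
    show "\<forall>\<^sub>F s in at_right t. g s < a"
      using q(1) by (auto simp: eventually_at_right_field intro!: exI[of _ "of_rat q"] le_less_trans[OF upper q(2)])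
  qed
qed

section \<open>Existence of regular conditional distributions\<close>

text \<open>Each density is fixed only up to a null set depending on \<open>t\<close>. The
  regularised family \<open>G\<close> is monotone and right-continuous everywhere, so only its
  limits at infinity can fail, and they do so on a null set, where the kernel is replaced. The
  kernel identity is proved for half-lines and extended to all Borel sets \<open>B\<close> with
  \<open>A\<close> held fixed.\<close>

lemma (in prob_space) exists_cond_kernel:
  fixes X :: "'a \<Rightarrow> real"
  assumes Y[measurable]: "Y \<in> M \<rightarrow>\<^sub>M N" and X[measurable]: "X \<in> borel_measurable M"
  shows "\<exists>K \<in> N \<rightarrow>\<^sub>M prob_algebra borel. \<forall>A\<in>sets N. \<forall>B\<in>sets borel.
    emeasure M {x\<in>space M. Y x \<in> A \<and> X x \<in> B} = (\<integral>\<^sup>+y\<in>A. emeasure (K y) B \<partial>distr M N Y)"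
proof -
  define \<nu> where "\<nu> = distr M N Y"
  have sets_\<nu>[measurable_cong]: "sets \<nu> = sets N" and space_\<nu>: "space \<nu> = space N"
    by (auto simp: \<nu>_def)
  interpret \<nu>: prob_space \<nu> unfolding \<nu>_def by (rule prob_space_distr) fact
  interpret D: prob_space "distr M borel X" by (rule prob_space_distr) fact
  interpret D: real_distribution "distr M borel X" by unfold_locales auto
  define F where "F = cdf (distr M borel X)"
  have F_eq: "F t = measure M {x\<in>space M. X x \<le> t}" for t
    by (auto simp: F_def cdf_def measure_distr intro!: arg_cong[where f="measure M"])

  have "\<exists>h. h \<in> borel_measurable N \<and> (\<forall>y. 0 \<le> h y \<and> h y \<le> 1) \<and>
    (\<forall>A\<in>sets N. emeasure M {x\<in>space M. Y x \<in> A \<and> X x \<le> t} = (\<integral>\<^sup>+y\<in>A. ennreal (h y) \<partial>\<nu>))" for t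
  proof -
    \<comment> \<open>\<open>L\<close> is the law of \<open>Y\<close> restricted to the event
      \<open>X\<close> at most \<open>t\<close>. It is dominated by \<open>\<nu>\<close>, so it has
      a density that is almost everywhere at most 1.\<close>
    define L where "L = distr (density M (indicator {x\<in>space M. X x \<le> t})) N Y"
    have sL: "sets L = sets \<nu>" by (simp add: L_def sets_\<nu>)
    have L: "emeasure L A = emeasure M {x\<in>space M. Y x \<in> A \<and> X x \<le> t}" if [measurable]: "A \<in> sets N" for A
    proof -
      have "emeasure L A = emeasure (density M (indicator {x\<in>space M. X x \<le> t})) (Y -` A \<inter> space M)"
        by (simp add: L_def emeasure_distr)
      also have "\<dots> = emeasure M ((Y -` A \<inter> space M) \<inter> {x\<in>space M. X x \<le> t})"
        by (subst emeasure_density) (auto simp: indicator_inter_arith[symmetric] Int_commute)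
      finally show ?thesis by (auto intro!: arg_cong[where f="emeasure M"])
    qed
    have Lle: "emeasure L A \<le> emeasure \<nu> A" if [measurable]: "A \<in> sets N" for A
      by (auto simp: L \<nu>_def emeasure_distr intro!: emeasure_mono)
    have ac: "absolutely_continuous \<nu> L"
      unfolding absolutely_continuous_def
    proof (rule subsetI)
      fix A assume A: "A \<in> null_sets \<nu>"
      then have "A \<in> sets N" using sets_\<nu> by auto
      then show "A \<in> null_sets L"
        using A Lle[of A] sL sets_\<nu> by (auto simp: null_sets_def)
    qed
    define r where "r = RN_deriv \<nu> L"
    have r[measurable]: "r \<in> borel_measurable N"
      unfolding r_def using borel_measurable_RN_deriv[of \<nu> L] sets_\<nu> by (simp cong: measurable_cong_sets)
    have Lr: "emeasure L A = (\<integral>\<^sup>+y\<in>A. r y \<partial>\<nu>)" if "A \<in> sets N" for A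
      using that by (subst \<nu>.density_RN_deriv[OF ac sL, symmetric], subst emeasure_density)
        (auto simp: sets_\<nu> r_def[symmetric] cong: measurable_cong_sets)
    have r1: "AE y in \<nu>. r y \<le> 1"
      using Lr Lle by (intro \<nu>.AE_le_if_set_nn_integral_le) (auto simp: sets_\<nu>)
    \<comment> \<open>Truncation at 1 alters \<open>r\<close> only on a null set and yields a
      real-valued version with bounds at every point, on which the later infima over rationals
      rely.\<close>
    define h where "h y = enn2real (min 1 (r y))" for y
    have h[simp]: "ennreal (h y) = min 1 (r y)" for y
      by (auto simp: h_def less_top[symmetric] min_def top_unique intro!: ennreal_enn2real)
    show ?thesis
    proof (intro exI[of _ h] conjI allI ballI)
      show "h \<in> borel_measurable N" unfolding h_def by measurable
      show "0 \<le> h y" "h y \<le> 1" for y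
        by (auto simp: h_def enn2real_leI)
      fix A assume [measurable]: "A \<in> sets N"
      have "(\<integral>\<^sup>+y\<in>A. ennreal (h y) \<partial>\<nu>) = (\<integral>\<^sup>+y\<in>A. r y \<partial>\<nu>)"
        using r1 by (intro nn_integral_cong_AE) (auto simp: min_def split: split_indicator)
      then show "emeasure M {x\<in>space M. Y x \<in> A \<and> X x \<le> t} = (\<integral>\<^sup>+y\<in>A. ennreal (h y) \<partial>\<nu>)"
        using L Lr by simp
    qed
  qed
  then have "\<forall>t. \<exists>h. h \<in> borel_measurable N \<and> (\<forall>y. 0 \<le> h y \<and> h y \<le> 1) \<and>
    (\<forall>A\<in>sets N. emeasure M {x\<in>space M. Y x \<in> A \<and> X x \<le> t} = (\<integral>\<^sup>+y\<in>A. ennreal (h y) \<partial>\<nu>))" ..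
  from choice[OF this] obtain H where H[measurable]: "\<And>t. H t \<in> borel_measurable N"
    and H01: "\<And>t y. 0 \<le> H t y" "\<And>t y. H t y \<le> 1"
    and H_int: "\<And>t A. A \<in> sets N \<Longrightarrow>
      emeasure M {x\<in>space M. Y x \<in> A \<and> X x \<le> t} = (\<integral>\<^sup>+y\<in>A. ennreal (H t y) \<partial>\<nu>)"
    by blast
  have intH: "integrable \<nu> (H t)" for t
    using H01 by (intro \<nu>.integrable_const_bound[of _ 1]) auto
  have H_F: "integral\<^sup>L \<nu> (H t) = F t" for t
  proof -
    have "(\<integral>\<^sup>+y. ennreal (H t y) \<partial>\<nu>) = (\<integral>\<^sup>+y\<in>space N. ennreal (H t y) \<partial>\<nu>)"
      by (intro nn_integral_cong) (auto simp: space_\<nu>)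
    also have "\<dots> = emeasure M {x\<in>space M. X x \<le> t}"
      using measurable_space[OF Y] by (subst H_int[symmetric]) (auto intro!: arg_cong[where f="emeasure M"])
    also have "\<dots> = ennreal (F t)"
      by (simp add: F_eq emeasure_eq_measure)
    finally show ?thesis
      by (subst integral_eq_nn_integral) (auto simp: H01 F_eq)
  qed
  have H_mono: "AE y in \<nu>. H s y \<le> H t y" if "s \<le> t" for s t
  proof -
    have "AE y in \<nu>. ennreal (H s y) \<le> ennreal (H t y)"
    proof (rule \<nu>.AE_le_if_set_nn_integral_le)
      fix A assume "A \<in> sets \<nu>"
      then have [measurable]: "A \<in> sets N" by (simp add: sets_\<nu>)
      show "(\<integral>\<^sup>+y\<in>A. ennreal (H s y) \<partial>\<nu>) \<le> (\<integral>\<^sup>+y\<in>A. ennreal (H t y) \<partial>\<nu>)"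
        using that by (auto simp: H_int[symmetric] intro!: emeasure_mono)
    qed auto
    then show ?thesis by (simp add: H01)
  qed

  define G where "G y (t::real) = (INF q\<in>{q::rat. t < of_rat q}. H (of_rat q) y)" for y t
  note G = distribution_function_Inf_rat[of "\<lambda>t. H t y" "G y" for y, OF H01 G_def]
  have [measurable]: "(\<lambda>y. G y t) \<in> borel_measurable N" for t
    unfolding G_def using H01 by (intro borel_measurable_cINF) (auto intro!: bdd_belowI2[of _ 0])
  have intG: "integrable \<nu> (\<lambda>y. G y t)" for t
    using G(3,4) by (intro \<nu>.integrable_const_bound[of _ 1]) auto
  have G_H: "AE y in \<nu>. G y t = H t y" for t
  proof -
    \<comment> \<open>One inequality combines countably many comparisons, at the cost of a single
      null set. The other follows by integration: \<open>G y t\<close> lies below \<open>H\<close>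
      at each \<open>q n\<close>, so the integral of the gap is at most
      \<open>F (of_rat (q n)) - F t\<close>, which tends to 0 because \<open>F\<close> is
      right-continuous.\<close>
    have "AE y in \<nu>. \<forall>q\<in>{q::rat. t < of_rat q}. H t y \<le> H (of_rat q) y"
      by (subst AE_ball_countable) (auto intro!: H_mono)
    then have le: "AE y in \<nu>. H t y \<le> G y t"
      by eventually_elim (auto intro: G(2))
    have "\<exists>q::rat. t < of_rat q \<and> of_rat q < t + inverse (real (Suc n))" for n
      by (rule of_rat_dense) simp
    then obtain q :: "nat \<Rightarrow> rat" where q: "\<And>n. t < of_rat (q n)" "\<And>n. of_rat (q n) < t + inverse (real (Suc n))"
      by metis
    have q_lim: "(\<lambda>n. of_rat (q n) :: real) \<longlonglongrightarrow> t"
    proof (rule tendsto_sandwich[where f="\<lambda>_. t"])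
      show "(\<lambda>n. t + inverse (real (Suc n))) \<longlonglongrightarrow> t"
        by (rule LIMSEQ_inverse_real_of_nat_add)
      show "\<forall>\<^sub>F n in sequentially. t \<le> of_rat (q n)"
        using q(1) by (intro always_eventually allI less_imp_le)
      show "\<forall>\<^sub>F n in sequentially. of_rat (q n) \<le> t + inverse (real (Suc n))"
        using q(2) by (intro always_eventually allI less_imp_le)
    qed simp
    have "AE y in \<nu>. G y t - H t y = 0"
    proof (rule AE_zero_if_integral_le_null_sequence[where u="\<lambda>n. F (of_rat (q n)) - F t"])
      show "(\<integral>y. G y t - H t y \<partial>\<nu>) \<le> F (of_rat (q n)) - F t" for n
      proof -
        have "(\<integral>y. G y t \<partial>\<nu>) \<le> (\<integral>y. H (of_rat (q n)) y \<partial>\<nu>)"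
          using q(1) by (intro integral_mono intG intH G(1))
        then show ?thesis
          using intG intH by (simp add: H_F)
      qed
      have "of_rat (q n) \<noteq> t" for n
        using q(1)[of n] by simp
      with q_lim q(1) have "filterlim (\<lambda>n. of_rat (q n) :: real) (at_right t) sequentially"
        by (auto simp: filterlim_at)
      then have "(\<lambda>n. F (of_rat (q n))) \<longlonglongrightarrow> F t"
        using D.cdf_is_right_cont[of t] unfolding F_def continuous_within by (rule filterlim_compose[rotated])
      then show "(\<lambda>n. F (of_rat (q n)) - F t) \<longlonglongrightarrow> 0"
        by (simp add: LIM_zero)
    qed (use le intG intH in auto)
    then show ?thesis by simp
  qed
  have G_F: "(\<integral>y. G y t \<partial>\<nu>) = F t" for t
    using G_H[of t] by (subst H_F[symmetric], intro integral_cong_AE) auto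

  \<comment> \<open>By monotonicity these are the limits of \<open>G y\<close> at plus and minus
    infinity, expressed through countably many values and hence measurable. Their integrals are
    squeezed to 1 and 0 by the limits of \<open>F\<close>.\<close>
  define Gsup where "Gsup y = (SUP n. G y (real n))" for y
  define Ginf where "Ginf y = (INF n. G y (- real n))" for y
  have bdd_above: "bdd_above (range (\<lambda>n. G y (real n)))" for y
    using G(4) by (intro bdd_aboveI2[of _ _ 1]) auto
  have bdd_below: "bdd_below (range (\<lambda>n. G y (- real n)))" for y
    using G(3) by (intro bdd_belowI2[of _ 0]) auto
  have [measurable]: "Gsup \<in> borel_measurable N" "Ginf \<in> borel_measurable N"
    unfolding Gsup_def Ginf_def using bdd_above bdd_below
    by (auto intro!: borel_measurable_cSUP borel_measurable_cINF)
  have Gsup_ge: "G y (real n) \<le> Gsup y" for y n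
    unfolding Gsup_def using bdd_above by (intro cSUP_upper) auto
  have Gsup_le: "Gsup y \<le> 1" for y
    unfolding Gsup_def using G(4) by (intro cSUP_least) auto
  have Ginf_le: "Ginf y \<le> G y (- real n)" for y n
    unfolding Ginf_def using bdd_below by (intro cINF_lower) auto
  have Ginf_ge: "0 \<le> Ginf y" for y
    unfolding Ginf_def using G(3) by (intro cINF_greatest) auto
  have Gsup_nonneg: "0 \<le> Gsup y" for y
    using Gsup_ge[of y 0] G(3)[of y 0] by simp
  have Ginf_le_1: "Ginf y \<le> 1" for y
    using Ginf_le[of y 0] G(4)[of y 0] by simp
  have int: "integrable \<nu> Gsup" "integrable \<nu> Ginf"
    using Gsup_nonneg Gsup_le Ginf_ge Ginf_le_1 by (auto intro!: \<nu>.integrable_const_bound[of _ 1])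
  have "AE y in \<nu>. 1 - Gsup y = 0"
  proof (rule AE_zero_if_integral_le_null_sequence[where u="\<lambda>n. 1 - F (real n)"])
    show "(\<integral>y. 1 - Gsup y \<partial>\<nu>) \<le> 1 - F (real n)" for n
    proof -
      have "(\<integral>y. G y (real n) \<partial>\<nu>) \<le> (\<integral>y. Gsup y \<partial>\<nu>)"
        by (intro integral_mono intG int Gsup_ge)
      then show ?thesis using int by (simp add: G_F \<nu>.prob_space)
    qed
    have "(\<lambda>n. F (real n)) \<longlonglongrightarrow> 1"
      unfolding F_def by (rule filterlim_compose[OF D.cdf_lim_at_top_prob filterlim_real_sequentially])
    from tendsto_diff[OF tendsto_const[of 1] this]
    show "(\<lambda>n. 1 - F (real n)) \<longlonglongrightarrow> 0" by simp
  qed (use int Gsup_le in auto)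
  moreover have "AE y in \<nu>. Ginf y = 0"
  proof (rule AE_zero_if_integral_le_null_sequence[where u="\<lambda>n. F (- real n)"])
    show "(\<integral>y. Ginf y \<partial>\<nu>) \<le> F (- real n)" for n
      unfolding G_F[symmetric] by (intro integral_mono intG int Ginf_le)
    show "(\<lambda>n. F (- real n)) \<longlonglongrightarrow> 0"
      unfolding F_def
      by (rule filterlim_compose[OF D.cdf_lim_at_bot])
         (simp add: filterlim_uminus_at_bot filterlim_real_sequentially)
  qed (use int Ginf_ge in auto)
  ultimately have good: "AE y in \<nu>. Gsup y = 1 \<and> Ginf y = 0"
    by eventually_elim auto

  have G_at_top: "(G y \<longlongrightarrow> 1) at_top" if Gsup: "Gsup y = 1" for y
  proof (rule order_tendstoI)
    fix a :: real assume "a < 1"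
    then obtain n where n: "a < G y (real n)"
      using Gsup less_cSUP_iff[OF _ bdd_above, of a y] by (auto simp: Gsup_def)
    show "\<forall>\<^sub>F t in at_top. a < G y t"
      using eventually_ge_at_top[of "real n"]
      by eventually_elim (use n monoD[OF G(5)] less_le_trans in blast)
  next
    fix a :: real assume "1 < a"
    then show "\<forall>\<^sub>F t in at_top. G y t < a"
      using G(4) by (auto intro!: always_eventually le_less_trans[OF G(4)])
  qed
  have G_at_bot: "(G y \<longlongrightarrow> 0) at_bot" if Ginf: "Ginf y = 0" for y
  proof (rule order_tendstoI)
    fix a :: real assume "0 < a"
    then obtain n where n: "G y (- real n) < a"
      using Ginf cINF_less_iff[OF _ bdd_below, of y a] by (auto simp: Ginf_def)
    show "\<forall>\<^sub>F t in at_bot. G y t < a"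
      using eventually_le_at_bot[of "- real n"]
      by eventually_elim (use n monoD[OF G(5)] le_less_trans in blast)
  next
    fix a :: real assume "a < 0"
    then show "\<forall>\<^sub>F t in at_bot. a < G y t"
      using G(3) by (auto intro!: always_eventually less_le_trans[OF _ G(3)])
  qed

  \<comment> \<open>The point mass at 0 is an arbitrary default on a null set; it keeps
    \<open>K y\<close> a probability measure for every \<open>y\<close>, as
    \<open>prob_algebra\<close> demands.\<close>
  define K where "K y = (if Gsup y = 1 \<and> Ginf y = 0 then interval_measure (G y) else return borel 0)" for y
  have sets_K: "sets (K y) = sets borel" for y
    by (simp add: K_def)
  have prob_K: "prob_space (K y)" for y
  proof (cases "Gsup y = 1 \<and> Ginf y = 0")
    case True
    then have "real_distribution (interval_measure (G y))"
      using monoD[OF G(5)] G(6) G_at_top G_at_bot by (intro real_distribution_interval_measure) auto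
    then show ?thesis
      using True by (simp add: K_def real_distribution.axioms(1))
  qed (auto simp: K_def intro: prob_space_return)
  have K_good: "emeasure (K y) {..t} = ennreal (G y t)" if "Gsup y = 1" "Ginf y = 0" for y t
    using that monoD[OF G(5)] G(6) G_at_bot by (simp add: K_def emeasure_interval_measure_Iic)
  have K_Iic: "emeasure (K y) {..t} = (if Gsup y = 1 \<and> Ginf y = 0 then ennreal (G y t) else indicator {..t} 0)" for y t
    using K_good by (auto simp: K_def)
  have K[measurable]: "K \<in> N \<rightarrow>\<^sub>M prob_algebra borel"
    by (intro prob_kernel_measurable_if_Iic prob_K sets_K) (simp add: K_Iic)
  show ?thesis
  proof (intro bexI[of _ K] ballI)
    fix A and B :: "real set" assume [measurable]: "A \<in> sets N" "B \<in> sets borel"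
    \<comment> \<open>With \<open>A\<close> fixed, the two sides of the identity are measures in
      \<open>B\<close>: the left side is \<open>P\<close>, the right side is \<open>Q\<close> below.
      Agreement on half-lines then suffices.\<close>
    define P where "P = distr (density M (indicator {x\<in>space M. Y x \<in> A})) borel X"
    have P: "emeasure P C = emeasure M {x\<in>space M. Y x \<in> A \<and> X x \<in> C}"
      if [measurable]: "C \<in> sets borel" for C
    proof -
      have "emeasure P C = emeasure (density M (indicator {x\<in>space M. Y x \<in> A})) (X -` C \<inter> space M)"
        by (simp add: P_def emeasure_distr)
      also have "\<dots> = emeasure M ((X -` C \<inter> space M) \<inter> {x\<in>space M. Y x \<in> A})"
        by (subst emeasure_density) (auto simp: indicator_inter_arith[symmetric] Int_commute)
      finally show ?thesis by (auto intro!: arg_cong[where f="emeasure M"])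
    qed
    define Q where "Q = density \<nu> (indicator A) \<bind> K"
    have ne: "space N \<noteq> {}"
      using \<nu>.not_empty by (simp add: space_\<nu>)
    have K': "K \<in> density \<nu> (indicator A) \<rightarrow>\<^sub>M subprob_algebra borel"
      using measurable_prob_algebraD[OF K] by (simp add: sets_\<nu> cong: measurable_cong_sets)
    have K''[measurable]: "(\<lambda>y. emeasure (K y) C) \<in> borel_measurable N" if "C \<in> sets borel" for C
      using measurable_emeasure_kernel[OF measurable_prob_algebraD[OF K] that] .
    have Q: "emeasure Q C = (\<integral>\<^sup>+y\<in>A. emeasure (K y) C \<partial>\<nu>)" if [measurable]: "C \<in> sets borel" for C
      unfolding Q_def using ne
      by (subst emeasure_bind[OF _ K'])
         (auto simp: space_\<nu> nn_integral_density mult.commute)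
    have "P = Q"
    proof (rule measure_eqI_Iic)
      show "sets P = sets borel" by (simp add: P_def)
      show "sets Q = sets borel" unfolding Q_def using ne by (subst sets_bind[OF sets_kernel[OF K']]) (auto simp: space_\<nu>)
      show "emeasure P UNIV \<noteq> \<infinity>" by (simp add: P)
      fix t
      \<comment> \<open>For almost every \<open>y\<close> the mass of the half-line under
        \<open>K y\<close> is \<open>G y t\<close>, and this is \<open>H t y\<close> off a null set
        depending on \<open>t\<close>, which is harmless because \<open>t\<close> is fixed
        here.\<close>
      have "emeasure Q {..t} = (\<integral>\<^sup>+y\<in>A. H t y \<partial>\<nu>)"
        using good G_H[of t] by (subst Q, simp, intro nn_integral_cong_AE)
          (auto simp: K_Iic split: split_indicator elim!: eventually_elim2)
      then show "emeasure P {..t} = emeasure Q {..t}"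
        by (simp add: P H_int[symmetric])
    qed
    then show "emeasure M {x\<in>space M. Y x \<in> A \<and> X x \<in> B} = (\<integral>\<^sup>+y\<in>A. emeasure (K y) B \<partial>distr M N Y)"
      using P[of B] Q[of B] by (simp add: \<nu>_def)
  qed fact
qed

section \<open>Disintegration of integrals along a conditional kernel\<close>

text \<open>Drawing \<open>y\<close> from the law of \<open>Y\<close> and then \<open>t\<close> from
  \<open>K y\<close> gives a law for the pair that agrees with the joint law of
  \<open>(Y, X)\<close> on measurable rectangles, by the kernel identity. Rectangles form an
  intersection-stable generator, so the laws coincide, and the formula is integration against a
  bind.\<close>

lemma (in prob_space) nn_integral_cond_kernel:
  fixes X :: "'a \<Rightarrow> real"
  assumes Y[measurable]: "Y \<in> M \<rightarrow>\<^sub>M N" and X[measurable]: "X \<in> borel_measurable M"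
    and K[measurable]: "K \<in> N \<rightarrow>\<^sub>M prob_algebra borel"
    and kernel: "\<forall>A\<in>sets N. \<forall>B\<in>sets borel.
      emeasure M {x\<in>space M. Y x \<in> A \<and> X x \<in> B} = (\<integral>\<^sup>+y\<in>A. emeasure (K y) B \<partial>distr M N Y)"
    and f[measurable]: "f \<in> borel_measurable (N \<Otimes>\<^sub>M borel)"
  shows "(\<integral>\<^sup>+x. f (Y x, X x) \<partial>M) = (\<integral>\<^sup>+y. \<integral>\<^sup>+t. f (y, t) \<partial>K y \<partial>distr M N Y)"
proof -
  define P where "P = distr M (N \<Otimes>\<^sub>M borel) (\<lambda>x. (Y x, X x))"
  \<comment> \<open>\<open>J y\<close> places \<open>K y\<close> on the fibre over \<open>y\<close>,
    so that the bind remembers \<open>y\<close> together with \<open>t\<close>.\<close>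
  define J where "J y = distr (K y) (N \<Otimes>\<^sub>M (borel :: real measure)) (Pair y)" for y
  define Q where "Q = distr M N Y \<bind> J"
  have ne: "space N \<noteq> {}"
    using measurable_space[OF Y] not_empty by auto
  have J: "J \<in> N \<rightarrow>\<^sub>M subprob_algebra (N \<Otimes>\<^sub>M borel)"
    unfolding J_def by (intro measurable_distr2[where M=borel] measurable_prob_algebraD K) simp
  then have J': "J \<in> distr M N Y \<rightarrow>\<^sub>M subprob_algebra (N \<Otimes>\<^sub>M borel)"
    by simp
  have sets_K: "sets (K y) = sets borel" if "y \<in> space N" for y
    using subprob_measurableD(2)[OF measurable_prob_algebraD[OF K] that] .
  have pair[measurable]: "Pair y \<in> K y \<rightarrow>\<^sub>M N \<Otimes>\<^sub>M borel" if "y \<in> space N" for y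
    using that sets_K[OF that] by (simp cong: measurable_cong_sets)
  have "P = Q"
  proof (rule measure_eqI_generator_eq[OF Int_stable_pair_measure_generator pair_measure_closed])
    show "sets P = sigma_sets (space N \<times> space borel) {a \<times> b | a b. a \<in> sets N \<and> b \<in> sets borel}"
      by (simp add: P_def sets_pair_measure)
    show "sets Q = sigma_sets (space N \<times> space borel) {a \<times> b | a b. a \<in> sets N \<and> b \<in> sets borel}"
      using ne unfolding Q_def by (subst sets_bind[OF sets_kernel[OF J']]) (auto simp: sets_pair_measure)
    show "range (\<lambda>_::nat. space N \<times> space borel) \<subseteq> {a \<times> b | a b. a \<in> sets N \<and> b \<in> sets (borel :: real measure)}"
      using sets.top[of N] sets.top[of "borel :: real measure"] by blast
    interpret P: prob_space P
      unfolding P_def by (rule prob_space_distr) simp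
    show "emeasure P (space N \<times> space borel) \<noteq> \<infinity>" for i :: nat
      by simp
    fix C assume "C \<in> {a \<times> b | a b. a \<in> sets N \<and> b \<in> sets (borel :: real measure)}"
    then obtain A B where C: "C = A \<times> B" and [measurable]: "A \<in> sets N" "B \<in> sets borel"
      by auto
    have "emeasure P C = emeasure M {x\<in>space M. Y x \<in> A \<and> X x \<in> B}"
      by (auto simp: P_def C emeasure_distr intro!: arg_cong[where f="emeasure M"])
    also have "\<dots> = (\<integral>\<^sup>+y\<in>A. emeasure (K y) B \<partial>distr M N Y)"
      using kernel \<open>A \<in> sets N\<close> \<open>B \<in> sets borel\<close> by simp
    also have "\<dots> = (\<integral>\<^sup>+y. emeasure (J y) C \<partial>distr M N Y)"
    proof (rule nn_integral_cong)
      fix y assume "y \<in> space (distr M N Y)"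
      then have y: "y \<in> space N" by simp
      have "emeasure (J y) C = emeasure (K y) (Pair y -` (A \<times> B) \<inter> space (K y))"
        unfolding J_def C by (rule emeasure_distr[OF pair[OF y]]) simp
      also have "Pair y -` (A \<times> B) \<inter> space (K y) = (if y \<in> A then B else {})"
        using sets_eq_imp_space_eq[OF sets_K[OF y]] by auto
      finally show "emeasure (K y) B * indicator A y = emeasure (J y) C"
        by auto
    qed
    also have "\<dots> = emeasure Q C"
      unfolding Q_def using ne by (subst emeasure_bind[OF _ J']) (auto simp: C)
    finally show "emeasure P C = emeasure Q C" .
  qed auto
  have "(\<integral>\<^sup>+x. f (Y x, X x) \<partial>M) = (\<integral>\<^sup>+z. f z \<partial>P)"
    unfolding P_def by (subst nn_integral_distr) auto
  also have "\<dots> = (\<integral>\<^sup>+y. \<integral>\<^sup>+z. f z \<partial>J y \<partial>distr M N Y)"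
    unfolding \<open>P = Q\<close> Q_def by (rule nn_integral_bind[OF f J'])
  also have "\<dots> = (\<integral>\<^sup>+y. \<integral>\<^sup>+t. f (y, t) \<partial>K y \<partial>distr M N Y)"
    by (intro nn_integral_cong) (simp add: J_def nn_integral_distr[OF pair])
  finally show ?thesis .
qed

section \<open>Zero integrals and the positive and negative parts of an increment\<close>

text \<open>Since \<open>ennreal\<close> sends negative reals to 0, the two integrals are those of
  the positive and the negative part. Their equality expresses a vanishing integral only if the
  common value is finite, hence the second conjunct.\<close>

lemma has_bochner_integral_0_iff:
  fixes f :: "'a \<Rightarrow> real"
  assumes [measurable]: "f \<in> borel_measurable M"
  shows "has_bochner_integral M f 0 \<longleftrightarrow>
    (\<integral>\<^sup>+x. ennreal (f x) \<partial>M) = (\<integral>\<^sup>+x. ennreal (- f x) \<partial>M) \<and> (\<integral>\<^sup>+x. ennreal (f x) \<partial>M) < \<infinity>"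
proof -
  have "has_bochner_integral M f 0 \<longleftrightarrow> integrable M f \<and> integral\<^sup>L M f = 0"
    by (simp add: has_bochner_integral_iff)
  also have "\<dots> \<longleftrightarrow> integrable M f \<and>
      enn2real (\<integral>\<^sup>+x. ennreal (f x) \<partial>M) = enn2real (\<integral>\<^sup>+x. ennreal (- f x) \<partial>M)"
    by (auto simp: real_lebesgue_integral_def)
  also have "\<dots> \<longleftrightarrow> (\<integral>\<^sup>+x. ennreal (f x) \<partial>M) = (\<integral>\<^sup>+x. ennreal (- f x) \<partial>M) \<and> (\<integral>\<^sup>+x. ennreal (f x) \<partial>M) < \<infinity>"
    unfolding real_integrable_def
    by (cases "\<integral>\<^sup>+x. ennreal (f x) \<partial>M"; cases "\<integral>\<^sup>+x. ennreal (- f x) \<partial>M") (auto simp: top_unique)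
  finally show ?thesis .
qed

lemma (in prob_space) has_bochner_integral_diff_const_iff:
  fixes f :: "'a \<Rightarrow> real"
  shows "has_bochner_integral M f c \<longleftrightarrow> has_bochner_integral M (\<lambda>x. f x - c) 0"
proof
  have c: "has_bochner_integral M (\<lambda>_. c) c"
    by (simp add: has_bochner_integral_iff prob_space)
  show "has_bochner_integral M (\<lambda>x. f x - c) 0" if "has_bochner_integral M f c"
    using has_bochner_integral_diff[OF that c] by simp
  show "has_bochner_integral M f c" if "has_bochner_integral M (\<lambda>x. f x - c) 0"
    using has_bochner_integral_add[OF that c] by simp
qed

text \<open>The cut-off of \<open>ennreal\<close> at 0 makes the density the positive part of
  \<open>D\<close>; passing \<open>- D\<close> instead gives the negative part. A pair of such
  measures stands in for the signed image measure.\<close>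

definition pos_part_distr :: "'a measure \<Rightarrow> ('a \<Rightarrow> real) \<Rightarrow> 'b measure \<Rightarrow> ('a \<Rightarrow> 'b) \<Rightarrow> 'b measure"
  where "pos_part_distr M D N Y = distr (density M (\<lambda>x. ennreal (D x))) N Y"

lemma sets_pos_part_distr[simp, measurable_cong]: "sets (pos_part_distr M D N Y) = sets N"
  by (simp add: pos_part_distr_def)

text \<open>Splitting \<open>D\<close> into positive and negative part turns a test integral into a
  difference of integrals over the two image measures. It therefore vanishes exactly when both
  measures give the test function the same integral.\<close>

lemma
  fixes D :: "'a \<Rightarrow> real" and \<rho> :: "'b \<Rightarrow> real"
  assumes Y[measurable]: "Y \<in> M \<rightarrow>\<^sub>M N" and D: "integrable M D"
    and \<rho>[measurable]: "\<rho> \<in> borel_measurable N" and bdd: "\<And>y. y \<in> space N \<Longrightarrow> \<bar>\<rho> y\<bar> \<le> c"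
  shows integrable_bounded_mult_comp: "integrable M (\<lambda>x. \<rho> (Y x) * D x)"
    and integral_pos_part_distr_diff: "(\<integral>x. \<rho> (Y x) * D x \<partial>M) =
      (\<integral>y. \<rho> y \<partial>pos_part_distr M D N Y) - (\<integral>y. \<rho> y \<partial>pos_part_distr M (\<lambda>x. - D x) N Y)"
proof -
  have int: "integrable M (\<lambda>x. \<rho> (Y x) * g x)" if g: "integrable M g" for g :: "'a \<Rightarrow> real"
  proof (rule Bochner_Integration.integrable_bound)
    show "integrable M (\<lambda>x. c * g x)"
      using g by simp
    show "(\<lambda>x. \<rho> (Y x) * g x) \<in> borel_measurable M"
      using g by measurable
    show "AE x in M. norm (\<rho> (Y x) * g x) \<le> norm (c * g x)"
      using measurable_space[OF Y] bdd
      by (intro AE_I2) (auto simp: abs_mult intro!: mult_right_mono order_trans[OF bdd])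
  qed
  show "integrable M (\<lambda>x. \<rho> (Y x) * D x)"
    using D by (rule int)
  have push: "(\<integral>y. \<rho> y \<partial>pos_part_distr M g N Y) = (\<integral>x. \<rho> (Y x) * max 0 (g x) \<partial>M)"
    if [measurable]: "g \<in> borel_measurable M" for g
  proof -
    \<comment> \<open>Replacing \<open>g\<close> by its positive part leaves the measure unchanged
      and supplies the nonnegative real density required by
      \<open>integral_real_density\<close>.\<close>
    have "density M (\<lambda>x. ennreal (g x)) = density M (\<lambda>x. ennreal (max 0 (g x)))"
      by (intro density_cong) (auto simp: max_def ennreal_neg)
    then have "(\<integral>y. \<rho> y \<partial>pos_part_distr M g N Y) = (\<integral>x. \<rho> (Y x) \<partial>density M (\<lambda>x. ennreal (max 0 (g x))))"
      unfolding pos_part_distr_def by (simp add: integral_distr)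
    also have "\<dots> = (\<integral>x. max 0 (g x) * \<rho> (Y x) \<partial>M)"
      by (rule integral_real_density) auto
    finally show ?thesis by (simp add: mult.commute)
  qed
  have "(\<integral>x. \<rho> (Y x) * D x \<partial>M) = (\<integral>x. \<rho> (Y x) * max 0 (D x) - \<rho> (Y x) * max 0 (- D x) \<partial>M)"
    by (intro Bochner_Integration.integral_cong refl) (simp add: max_def)
  also have "\<dots> = (\<integral>x. \<rho> (Y x) * max 0 (D x) \<partial>M) - (\<integral>x. \<rho> (Y x) * max 0 (- D x) \<partial>M)"
    using D by (intro Bochner_Integration.integral_diff int) auto
  finally show "(\<integral>x. \<rho> (Y x) * D x \<partial>M) =
      (\<integral>y. \<rho> y \<partial>pos_part_distr M D N Y) - (\<integral>y. \<rho> y \<partial>pos_part_distr M (\<lambda>x. - D x) N Y)"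
    using D by (simp add: push)
qed

lemma finite_pos_part_distr:
  assumes [measurable]: "Y \<in> M \<rightarrow>\<^sub>M N" and D: "integrable M D"
  shows "finite_measure (pos_part_distr M D N Y)"
  unfolding pos_part_distr_def
proof (rule finite_measure.finite_measure_distr)
  have [measurable]: "D \<in> borel_measurable M" using D by auto
  have "(\<integral>\<^sup>+x. ennreal (D x) \<partial>M) \<noteq> \<infinity>"
    using D unfolding real_integrable_def by auto
  then show "finite_measure (density M (\<lambda>x. ennreal (D x)))"
    by (intro finite_measureI) (simp add: emeasure_density cong: nn_integral_cong)
qed simp

text \<open>Given \<open>Y = y\<close> the subtracted term is the constant \<open>c y\<close>, so
  equality of the two densities at \<open>y\<close>, when finite, says that \<open>t - c y\<close>
  has integral 0 under \<open>K y\<close>. In the application \<open>c\<close> reads off the last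
  coordinate of \<open>Y\<close>.\<close>

lemma (in prob_space) pos_part_distr_eq_iff_cond_kernel_mean:
  fixes X :: "'a \<Rightarrow> real"
  assumes Y[measurable]: "Y \<in> M \<rightarrow>\<^sub>M N" and X[measurable]: "X \<in> borel_measurable M"
    and K[measurable]: "K \<in> N \<rightarrow>\<^sub>M prob_algebra borel"
    and kernel: "\<forall>A\<in>sets N. \<forall>B\<in>sets borel.
      emeasure M {x\<in>space M. Y x \<in> A \<and> X x \<in> B} = (\<integral>\<^sup>+y\<in>A. emeasure (K y) B \<partial>distr M N Y)"
    and c[measurable]: "c \<in> borel_measurable N"
    and int: "integrable M (\<lambda>x. X x - c (Y x))"
  shows "pos_part_distr M (\<lambda>x. X x - c (Y x)) N Y = pos_part_distr M (\<lambda>x. - (X x - c (Y x))) N Y \<longleftrightarrow>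
    (AE y in distr M N Y. has_bochner_integral (K y) (\<lambda>t. t) (c y))"
proof -
  let ?\<nu> = "distr M N Y"
  interpret \<nu>: prob_space ?\<nu> by (rule prob_space_distr) fact
  have push: "pos_part_distr M (\<lambda>x. f (Y x, X x)) N Y = density ?\<nu> (\<lambda>y. \<integral>\<^sup>+t. ennreal (f (y, t)) \<partial>K y)"
    and meas: "(\<lambda>y. \<integral>\<^sup>+t. ennreal (f (y, t)) \<partial>K y) \<in> borel_measurable N"
    if [measurable]: "f \<in> borel_measurable (N \<Otimes>\<^sub>M borel)" for f
  proof -
    show [measurable]: "(\<lambda>y. \<integral>\<^sup>+t. ennreal (f (y, t)) \<partial>K y) \<in> borel_measurable N"
      by (rule nn_integral_measurable_subprob_algebra2[OF _ measurable_prob_algebraD[OF K]]) simp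
    show "pos_part_distr M (\<lambda>x. f (Y x, X x)) N Y = density ?\<nu> (\<lambda>y. \<integral>\<^sup>+t. ennreal (f (y, t)) \<partial>K y)"
    proof (rule measure_eqI)
      fix A assume "A \<in> sets (pos_part_distr M (\<lambda>x. f (Y x, X x)) N Y)"
      then have [measurable]: "A \<in> sets N" by simp
      have "emeasure (pos_part_distr M (\<lambda>x. f (Y x, X x)) N Y) A =
          (\<integral>\<^sup>+x. ennreal (f (Y x, X x)) * indicator (Y -` A \<inter> space M) x \<partial>M)"
        unfolding pos_part_distr_def by (simp add: emeasure_distr emeasure_density)
      also have "\<dots> = (\<integral>\<^sup>+x. ennreal (f (Y x, X x)) * indicator A (Y x) \<partial>M)"
        by (intro nn_integral_cong) (simp add: indicator_def)
      also have "\<dots> = (\<integral>\<^sup>+y. \<integral>\<^sup>+t. ennreal (f (y, t)) * indicator A y \<partial>K y \<partial>?\<nu>)"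
      proof -
        have "(\<lambda>z. ennreal (f z) * indicator A (fst z)) \<in> borel_measurable (N \<Otimes>\<^sub>M borel)"
          by measurable
        from nn_integral_cond_kernel[OF Y X K kernel this] show ?thesis
          by (simp only: fst_conv)
      qed
      also have "\<dots> = (\<integral>\<^sup>+y. (\<integral>\<^sup>+t. ennreal (f (y, t)) \<partial>K y) * indicator A y \<partial>?\<nu>)"
        by (intro nn_integral_cong) (simp add: indicator_def)
      finally show "emeasure (pos_part_distr M (\<lambda>x. f (Y x, X x)) N Y) A =
          emeasure (density ?\<nu> (\<lambda>y. \<integral>\<^sup>+t. ennreal (f (y, t)) \<partial>K y)) A"
        by (simp add: emeasure_density)
    qed simp
  qed
  define p where "p y = (\<integral>\<^sup>+t. ennreal (t - c y) \<partial>K y)" for y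
  define q where "q y = (\<integral>\<^sup>+t. ennreal (- (t - c y)) \<partial>K y)" for y
  have p: "p \<in> borel_measurable N" and q: "q \<in> borel_measurable N"
    unfolding p_def q_def
    using meas[of "\<lambda>z. snd z - c (fst z)"] meas[of "\<lambda>z. - (snd z - c (fst z))"] by simp_all
  have "pos_part_distr M (\<lambda>x. X x - c (Y x)) N Y = density ?\<nu> p"
    unfolding p_def using push[of "\<lambda>z. snd z - c (fst z)"] by simp
  moreover have "pos_part_distr M (\<lambda>x. - (X x - c (Y x))) N Y = density ?\<nu> q"
    unfolding q_def using push[of "\<lambda>z. - (snd z - c (fst z))"] by simp
  moreover have "AE y in ?\<nu>. p y = q y \<longleftrightarrow> has_bochner_integral (K y) (\<lambda>t. t) (c y)"
  proof -
    \<comment> \<open>If \<open>p y\<close> and \<open>q y\<close> were both infinite, they would be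
      equal although the identity is not integrable under \<open>K y\<close>. Integrability of the
      increment makes the integral of \<open>p\<close> finite and confines this case to a null
      set.\<close>
    have "(\<integral>\<^sup>+y. p y \<partial>?\<nu>) = (\<integral>\<^sup>+x. ennreal (X x - c (Y x)) \<partial>M)"
      unfolding p_def
      using nn_integral_cond_kernel[OF Y X K kernel, of "\<lambda>z. ennreal (snd z - c (fst z))"] by simp
    also have "\<dots> \<noteq> \<infinity>"
      using int unfolding real_integrable_def by auto
    finally have "AE y in ?\<nu>. p y \<noteq> \<infinity>"
      using p by (intro nn_integral_PInf_AE) auto
    with AE_space show ?thesis
    proof eventually_elim
      case (elim y)
      then have "y \<in> space N" by simp
      then interpret K: prob_space "K y"
        using measurable_space[OF K] by (simp add: space_prob_algebra)
      have sets_K[measurable_cong]: "sets (K y) = sets borel"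
        using subprob_measurableD(2)[OF measurable_prob_algebraD[OF K] \<open>y \<in> space N\<close>] .
      have [measurable]: "(\<lambda>t. t - c y) \<in> borel_measurable (K y)"
        by measurable
      show ?case
        using elim
        by (subst K.has_bochner_integral_diff_const_iff, subst has_bochner_integral_0_iff)
           (auto simp: p_def q_def less_top)
    qed
  qed
  then have "(AE y in ?\<nu>. p y = q y) \<longleftrightarrow> (AE y in ?\<nu>. has_bochner_integral (K y) (\<lambda>t. t) (c y))"
    by (auto elim: eventually_elim2)
  ultimately show ?thesis
    using p q by (simp add: \<nu>.density_unique_iff)
qed

section \<open>Bounded continuous functions determine finite Borel measures on R^k\<close>

text \<open>The route goes through the product over all natural numbers, whose topology is that of a
  type: there \<open>\<rho>\<close> composed with restriction is continuous, hence Borel. Extension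
  by 0 maps \<open>borel_Rn k\<close> measurably into this product, and restriction undoes
  it.\<close>

lemma bounded_continuous_measurable:
  assumes "\<rho> \<in> bounded_continuous k"
  shows "\<rho> \<in> borel_measurable (borel_Rn k)"
proof -
  have "continuous_map (product_topology (\<lambda>_. euclidean) UNIV) (top_Rn k) (\<lambda>x::nat \<Rightarrow> real. restrict x {1..k})"
    by (auto simp: continuous_map_componentwise intro!: continuous_map_product_projection)
  then have "continuous_map (product_topology (\<lambda>_. euclidean) UNIV) euclidean (\<lambda>x::nat \<Rightarrow> real. \<rho> (restrict x {1..k}))"
    using assms continuous_map_compose[of _ "top_Rn k" _ euclidean \<rho>]
    by (auto simp: bounded_continuous_def o_def)
  then have "continuous_on UNIV (\<lambda>x::nat \<Rightarrow> real. \<rho> (restrict x {1..k}))"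
    by (simp add: euclidean_product_topology)
  then have "(\<lambda>x::nat \<Rightarrow> real. \<rho> (restrict x {1..k})) \<in> borel_measurable borel"
    by (rule borel_measurable_continuous_onI)
  then have "(\<lambda>x::nat \<Rightarrow> real. \<rho> (restrict x {1..k})) \<in> borel_measurable (Pi\<^sub>M UNIV (\<lambda>_. borel))"
    by (subst measurable_cong_sets[OF sets_PiM_equal_borel refl])
  moreover have "(\<lambda>x i. if i \<in> {1..k} then x i else 0) \<in> borel_Rn k \<rightarrow>\<^sub>M Pi\<^sub>M UNIV (\<lambda>_. borel)"
  proof (rule measurable_PiM_single')
    show "(\<lambda>x. if i \<in> {1..k} then x i else 0) \<in> borel_measurable (borel_Rn k)" for i
      by (cases "i \<in> {1..k}") auto
  qed auto
  ultimately have "(\<lambda>x. \<rho> (restrict (\<lambda>i. if i \<in> {1..k} then x i else 0) {1..k})) \<in> borel_measurable (borel_Rn k)"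
    by (rule measurable_compose[rotated])
  moreover have "\<rho> (restrict (\<lambda>i. if i \<in> {1..k} then x i else 0) {1..k}) = \<rho> x" if "x \<in> space (borel_Rn k)" for x
    using that by (intro arg_cong[where f=\<rho>] ext) (auto simp: space_PiM PiE_def extensional_def)
  ultimately show ?thesis
    using measurable_cong[of "borel_Rn k" "\<lambda>x. \<rho> (restrict (\<lambda>i. if i \<in> {1..k} then x i else 0) {1..k})" \<rho>]
    by blast
qed

lemma bounded_continuousD_bound:
  assumes "\<rho> \<in> bounded_continuous k"
  obtains c where "\<And>y. y \<in> space (borel_Rn k) \<Longrightarrow> \<bar>\<rho> y\<bar> \<le> c"
  using assms by (auto simp: bounded_continuous_def bounded_iff space_PiM)

definition lower_orthant :: "nat \<Rightarrow> (nat \<Rightarrow> real) \<Rightarrow> (nat \<Rightarrow> real) set"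
  where "lower_orthant k a = {x \<in> {1..k} \<rightarrow>\<^sub>E UNIV. \<forall>i\<in>{1..k}. x i \<le> a i}"

text \<open>Half-lines generate each factor. With \<open>{1..k}\<close> as the only index set
  \<open>j\<close>, the cylinder sets over half-lines are exactly the orthants.\<close>

lemma sets_borel_Rn_lower_orthant:
  "sets (borel_Rn k) = sigma_sets ({1..k} \<rightarrow>\<^sub>E UNIV) (range (lower_orthant k))"
proof -
  let ?E = "\<lambda>_::nat. range (atMost :: real \<Rightarrow> real set)"
  have "sets (borel_Rn k) = sets (Pi\<^sub>M {1..k} (\<lambda>i. sigma UNIV (?E i)))"
    by (simp add: borel_eq_atMost)
  also have "\<dots> = sets (sigma ({1..k} \<rightarrow>\<^sub>E UNIV)
      {{f \<in> {1..k} \<rightarrow>\<^sub>E UNIV. \<forall>i\<in>j. f i \<in> A i} |A j. j \<in> {{1..k}} \<and> A \<in> Pi j ?E})"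
  proof (rule sets_PiM_sigma)
    \<comment> \<open>\<open>sets_PiM_sigma\<close> asks that countably many generators cover each
      factor; half-lines with natural endpoints do.\<close>
    show "\<exists>S\<subseteq>range atMost. countable S \<and> (UNIV :: real set) = \<Union> S"
      by (intro exI[of _ "range (\<lambda>n::nat. {..real n})"]) (auto intro: real_arch_simple)
  qed auto
  also have "{{f \<in> {1..k} \<rightarrow>\<^sub>E UNIV. \<forall>i\<in>j. f i \<in> A i} |A j. j \<in> {{1..k}} \<and> A \<in> Pi j ?E} = range (lower_orthant k)"
    (is "?L = _")
  proof (intro equalityI subsetI)
    fix B assume "B \<in> ?L"
    then obtain A where B: "B = {f \<in> {1..k} \<rightarrow>\<^sub>E UNIV. \<forall>i\<in>{1..k}. f i \<in> A i}" and A: "A \<in> Pi {1..k} ?E"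
      by auto
    from A have "\<forall>i\<in>{1..k}. \<exists>a. A i = {..a}"
      by auto
    then obtain a where "\<forall>i\<in>{1..k}. A i = {..a i}"
      by metis
    then have "B = lower_orthant k a"
      by (auto simp: B lower_orthant_def)
    then show "B \<in> range (lower_orthant k)" by simp
  next
    fix B assume "B \<in> range (lower_orthant k)"
    then obtain a where "B = lower_orthant k a" by auto
    then show "B \<in> ?L"
      by (auto simp: lower_orthant_def intro!: exI[of _ "\<lambda>i. {..a i}"])
  qed
  also have "sets (sigma ({1..k} \<rightarrow>\<^sub>E UNIV) (range (lower_orthant k))) =
      sigma_sets ({1..k} \<rightarrow>\<^sub>E UNIV) (range (lower_orthant k))"
    by (intro sets_measure_of) (auto simp: lower_orthant_def)
  finally show ?thesis .
qed

text \<open>For \<open>m > 0\<close> each factor is a ramp: 1 up to \<open>a i\<close>, then falling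
  linearly to 0 at \<open>a i + 1 / m\<close>. The closed orthant is thus approximated from outside,
  and the limit is correct on its boundary too.\<close>

definition orthant_approx :: "nat \<Rightarrow> (nat \<Rightarrow> real) \<Rightarrow> nat \<Rightarrow> (nat \<Rightarrow> real) \<Rightarrow> real"
  where "orthant_approx k a m x = (\<Prod>i\<in>{1..k}. max 0 (min 1 (1 + real m * (a i - x i))))"

lemma orthant_approx_bounds: "0 \<le> orthant_approx k a m x" "orthant_approx k a m x \<le> 1"
  unfolding orthant_approx_def by (auto intro!: prod_nonneg prod_le_1)

lemma orthant_approx_bounded_continuous: "orthant_approx k a m \<in> bounded_continuous k"
  unfolding bounded_continuous_def
proof (intro CollectI conjI)
  show "continuous_map (top_Rn k) euclidean (orthant_approx k a m)"
    unfolding orthant_approx_def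
    by (intro continuous_intros) auto
  show "bounded (orthant_approx k a m ` topspace (top_Rn k))"
    using orthant_approx_bounds by (auto simp: bounded_iff intro!: exI[of _ 1])
qed

lemma orthant_approx_tendsto:
  assumes "x \<in> space (borel_Rn k)"
  shows "(\<lambda>m. orthant_approx k a m x) \<longlonglongrightarrow> indicator (lower_orthant k a) x"
proof -
  have "(\<lambda>m. max 0 (min 1 (1 + real m * d))) \<longlonglongrightarrow> (if 0 \<le> d then 1 else 0)" for d :: real
  proof (cases "0 \<le> d")
    case False
    then have "filterlim (\<lambda>m. 1 + real m * d) at_bot sequentially"
      by real_asymp
    then have "\<forall>\<^sub>F m in sequentially. 1 + real m * d \<le> 0"
      by (simp add: filterlim_at_bot)
    then have "\<forall>\<^sub>F m in sequentially. max 0 (min 1 (1 + real m * d)) = 0"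
      by eventually_elim auto
    then show ?thesis
      using False by (simp add: tendsto_eventually)
  qed (simp add: min_def)
  then have "(\<lambda>m. orthant_approx k a m x) \<longlonglongrightarrow> (\<Prod>i\<in>{1..k}. if 0 \<le> a i - x i then 1 else 0)"
    unfolding orthant_approx_def by (intro tendsto_prod)
  also have "(\<Prod>i\<in>{1..k}. if 0 \<le> a i - x i then 1 else 0) = (indicator (lower_orthant k a) x :: real)"
    using assms by (auto simp: lower_orthant_def indicator_def space_PiM prod_zero_iff)
  finally show ?thesis .
qed

text \<open>The ramps are admissible test functions, and by dominated convergence with bound 1 their
  integrals tend to the mass of the orthant. Orthants are stable under intersection and generate the
  Borel sets, so equal masses on them give equal measures.\<close>

lemma finite_measure_eqI_bounded_continuous:
  assumes P: "finite_measure P" "sets P = sets (borel_Rn k)"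
    and Q: "finite_measure Q" "sets Q = sets (borel_Rn k)"
    and eq: "\<And>\<rho>. \<rho> \<in> bounded_continuous k \<Longrightarrow> (\<integral>y. \<rho> y \<partial>P) = (\<integral>y. \<rho> y \<partial>Q)"
  shows "P = Q"
proof (rule measure_eqI_generator_eq[where E="range (lower_orthant k)" and \<Omega>="{1..k} \<rightarrow>\<^sub>E UNIV"
      and A="\<lambda>n. lower_orthant k (\<lambda>_. real n)"])
  interpret P: finite_measure P by fact
  interpret Q: finite_measure Q by fact
  show "Int_stable (range (lower_orthant k))"
    unfolding Int_stable_def
  proof clarify
    fix a b
    have "lower_orthant k a \<inter> lower_orthant k b = lower_orthant k (\<lambda>i. min (a i) (b i))"
      by (auto simp: lower_orthant_def)
    then show "lower_orthant k a \<inter> lower_orthant k b \<in> range (lower_orthant k)"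
      by simp
  qed
  show "sets P = sigma_sets ({1..k} \<rightarrow>\<^sub>E UNIV) (range (lower_orthant k))"
    "sets Q = sigma_sets ({1..k} \<rightarrow>\<^sub>E UNIV) (range (lower_orthant k))"
    using P Q sets_borel_Rn_lower_orthant by auto
  show "(\<Union>n. lower_orthant k (\<lambda>_. real n)) = {1..k} \<rightarrow>\<^sub>E UNIV"
  proof (intro equalityI subsetI)
    fix x :: "nat \<Rightarrow> real" assume x: "x \<in> {1..k} \<rightarrow>\<^sub>E UNIV"
    \<comment> \<open>The inserted 0 keeps the set nonempty when \<open>k\<close> is 0.\<close>
    obtain n where "Max (insert 0 (x ` {1..k})) \<le> real n"
      using real_arch_simple by blast
    then show "x \<in> (\<Union>n. lower_orthant k (\<lambda>_. real n))"
      using x by (auto simp: lower_orthant_def)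
  qed (auto simp: lower_orthant_def)
  fix B assume "B \<in> range (lower_orthant k)"
  then obtain a where B: "B = lower_orthant k a" by auto
  have "B \<in> sets (borel_Rn k)"
    unfolding sets_borel_Rn_lower_orthant B by auto
  have lim: "(\<lambda>m. \<integral>y. orthant_approx k a m y \<partial>R) \<longlonglongrightarrow> measure R B"
    if R: "finite_measure R" "sets R = sets (borel_Rn k)" for R
  proof -
    interpret R: finite_measure R by fact
    have [measurable]: "orthant_approx k a m \<in> borel_measurable R" for m
      using bounded_continuous_measurable[OF orthant_approx_bounded_continuous]
      by (simp cong: measurable_cong_sets add: R)
    have [measurable]: "B \<in> sets R"
      using \<open>B \<in> sets (borel_Rn k)\<close> R by simp
    have "(\<lambda>m. \<integral>y. orthant_approx k a m y \<partial>R) \<longlonglongrightarrow> (\<integral>y. indicator B y \<partial>R)"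
    proof (rule integral_dominated_convergence[where w="\<lambda>_. 1"])
      show "AE y in R. (\<lambda>m. orthant_approx k a m y) \<longlonglongrightarrow> indicator B y"
        using sets_eq_imp_space_eq[OF R(2)] unfolding B
        by (intro AE_I2 orthant_approx_tendsto) simp
    qed (auto simp: orthant_approx_bounds)
    then show ?thesis by simp
  qed
  have "measure P B = measure Q B"
    using LIMSEQ_unique[OF lim[OF P]] lim[OF Q] eq[OF orthant_approx_bounded_continuous] by simp
  then show "emeasure P B = emeasure Q B"
    by (simp add: P.emeasure_eq_measure Q.emeasure_eq_measure)
qed (use assms in \<open>auto simp: lower_orthant_def finite_measure.finite_emeasure_space finite_measure.emeasure_finite\<close>)

section \<open>Couplings and the martingale condition\<close>

lemma proj_first_measurable: "k \<le> n \<Longrightarrow> proj_first k \<in> borel_Rn n \<rightarrow>\<^sub>M borel_Rn k"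
  unfolding proj_first_def by (intro measurable_restrict_subset) auto

lemma zero_bounded_continuous: "(\<lambda>_. 0) \<in> bounded_continuous k"
  by (auto simp: bounded_continuous_def bounded_iff)

lemma coordinate_measurable: "i \<in> {1..n} \<Longrightarrow> (\<lambda>x. x i) \<in> borel_measurable (borel_Rn n)"
  by (rule measurable_component_singleton)

lemma couplings_integrable_coordinate:
  assumes "\<pi> \<in> couplings n \<mu>" "i \<in> {1..n}" "integrable (\<mu> i) (\<lambda>t. t)"
  shows "integrable \<pi> (\<lambda>x. x i)"
proof -
  have sets: "sets \<pi> = sets (borel_Rn n)" and distr: "distr \<pi> borel (\<lambda>x. x i) = \<mu> i"
    using assms by (auto simp: couplings_def)
  have "(\<lambda>x. x i) \<in> borel_measurable \<pi>"
    using coordinate_measurable[OF assms(2)] by (simp cong: measurable_cong_sets add: sets)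
  then show ?thesis
    by (rule integrable_distr) (use assms(3) distr in simp)
qed

text \<open>Existence of a conditional kernel makes the choice behind \<open>cond_distr\<close> a
  genuine version. The argument below uses nothing else about it, so it is valid for every
  version.\<close>

lemma is_cond_distr_cond_distr:
  assumes "\<pi> \<in> couplings n \<mu>" "k < n"
  shows "is_cond_distr \<pi> k (cond_distr \<pi> k)"
proof -
  have sets[measurable_cong]: "sets \<pi> = sets (borel_Rn n)" and "prob_space \<pi>"
    using assms by (auto simp: couplings_def)
  then interpret prob_space \<pi> by simp
  have "proj_first k \<in> \<pi> \<rightarrow>\<^sub>M borel_Rn k"
    using proj_first_measurable[of k n] assms(2) by (simp cong: measurable_cong_sets add: sets)
  moreover have "(\<lambda>x. x (k + 1)) \<in> borel_measurable \<pi>"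
    using coordinate_measurable[of "k + 1" n] assms(2) by (simp cong: measurable_cong_sets add: sets)
  ultimately have "\<exists>K. is_cond_distr \<pi> k K"
    using exists_cond_kernel[of "proj_first k" "borel_Rn k" "\<lambda>x. x (k + 1)"]
    unfolding is_cond_distr_def by blast
  then show ?thesis
    unfolding cond_distr_def by (rule someI_ex)
qed

lemma martingale_step_iff:
  assumes \<pi>: "\<pi> \<in> couplings n \<mu>" and k: "k \<in> {1..<n}"
    and int: "\<And>i. i \<in> {1..n} \<Longrightarrow> integrable (\<mu> i) (\<lambda>t. t)"
  shows "(\<forall>\<rho>\<in>bounded_continuous k. has_bochner_integral \<pi> (\<lambda>x. \<rho> (proj_first k x) * (x (k + 1) - x k)) 0) \<longleftrightarrow>
    (AE x in distr \<pi> (borel_Rn k) (proj_first k). has_bochner_integral (cond_distr \<pi> k x) (\<lambda>t. t) (x k))"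
    (is "?tests \<longleftrightarrow> ?mart")
proof -
  let ?Y = "proj_first k" and ?N = "borel_Rn k" and ?D = "\<lambda>x. x (k + 1) - x k"
  let ?P = "pos_part_distr \<pi> ?D ?N ?Y" and ?Q = "pos_part_distr \<pi> (\<lambda>x. - ?D x) ?N ?Y"
  have sets[measurable_cong]: "sets \<pi> = sets (borel_Rn n)" and "prob_space \<pi>"
    using \<pi> by (auto simp: couplings_def)
  then interpret prob_space \<pi> by simp
  have Y: "?Y \<in> \<pi> \<rightarrow>\<^sub>M ?N"
    using proj_first_measurable[of k n] k by (simp cong: measurable_cong_sets add: sets)
  have X: "(\<lambda>x. x (k + 1)) \<in> borel_measurable \<pi>"
    using coordinate_measurable[of "k + 1" n] k by (simp cong: measurable_cong_sets add: sets)
  \<comment> \<open>The finite first moments of the marginals enter here.\<close>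
  have D: "integrable \<pi> ?D"
    using k by (intro Bochner_Integration.integrable_diff couplings_integrable_coordinate[OF \<pi>] int) auto
  have "?tests \<longleftrightarrow> ?P = ?Q"
  proof
    assume tests: ?tests
    show "?P = ?Q"
    proof (rule finite_measure_eqI_bounded_continuous)
      show "finite_measure ?P" "finite_measure ?Q"
        by (intro finite_pos_part_distr Y D Bochner_Integration.integrable_minus)+
      fix \<rho> assume \<rho>: "\<rho> \<in> bounded_continuous k"
      then obtain c where "\<And>y. y \<in> space ?N \<Longrightarrow> \<bar>\<rho> y\<bar> \<le> c"
        by (rule bounded_continuousD_bound) blast
      from integral_pos_part_distr_diff[OF Y D bounded_continuous_measurable[OF \<rho>] this]
      show "(\<integral>y. \<rho> y \<partial>?P) = (\<integral>y. \<rho> y \<partial>?Q)"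
        using tests \<rho> by (simp add: has_bochner_integral_iff)
    qed simp_all
  next
    assume eq: "?P = ?Q"
    show ?tests
    proof
      fix \<rho> assume \<rho>: "\<rho> \<in> bounded_continuous k"
      then obtain c where c: "\<And>y. y \<in> space ?N \<Longrightarrow> \<bar>\<rho> y\<bar> \<le> c"
        by (rule bounded_continuousD_bound) blast
      show "has_bochner_integral \<pi> (\<lambda>x. \<rho> (?Y x) * ?D x) 0"
        unfolding has_bochner_integral_iff
        using integrable_bounded_mult_comp[OF Y D bounded_continuous_measurable[OF \<rho>] c]
          integral_pos_part_distr_diff[OF Y D bounded_continuous_measurable[OF \<rho>] c] eq
        by simp
    qed
  qed
  also have "?P = ?Q \<longleftrightarrow> ?mart"
  proof -
    \<comment> \<open>As \<open>k\<close> is at least 1, the current value is itself a coordinate of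
      the conditioning vector; this is what lets \<open>c\<close> be evaluation at
      \<open>k\<close>.\<close>
    have coord: "?Y x k = x k" for x
      using k by (simp add: proj_first_def)
    have "is_cond_distr \<pi> k (cond_distr \<pi> k)"
      using k by (intro is_cond_distr_cond_distr[OF \<pi>]) simp
    then have K: "cond_distr \<pi> k \<in> ?N \<rightarrow>\<^sub>M prob_algebra borel"
      and kernel: "\<forall>A\<in>sets ?N. \<forall>B\<in>sets borel. emeasure \<pi> {x\<in>space \<pi>. ?Y x \<in> A \<and> x (k + 1) \<in> B} =
        (\<integral>\<^sup>+y\<in>A. emeasure (cond_distr \<pi> k y) B \<partial>distr \<pi> ?N ?Y)"
      unfolding is_cond_distr_def by auto
    have "(\<lambda>y. y k) \<in> borel_measurable ?N"
      using k by (intro coordinate_measurable) auto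
    moreover have "integrable \<pi> (\<lambda>x. x (k + 1) - ?Y x k)"
      using D by (simp only: coord)
    ultimately show ?thesis
      using pos_part_distr_eq_iff_cond_kernel_mean[OF Y X K kernel, of "\<lambda>y. y k"] by (simp only: coord)
  qed
  finally show ?thesis .
qed

text \<open>Choosing the zero function for every index other than \<open>k\<close> isolates one
  summand. Conversely, integrability and vanishing of each summand pass to the finite sum.\<close>

lemma martingale_tests_iff:
  "(\<forall>w\<in>martingale_tests n. has_bochner_integral \<pi> w 0) \<longleftrightarrow>
    (\<forall>k\<in>{1..<n}. \<forall>\<rho>\<in>bounded_continuous k.
      has_bochner_integral \<pi> (\<lambda>x. \<rho> (proj_first k x) * (x (k + 1) - x k)) 0)"
proof (intro iffI ballI)
  fix k \<rho> assume tests: "\<forall>w\<in>martingale_tests n. has_bochner_integral \<pi> w 0"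
    and k: "k \<in> {1..<n}" and \<rho>: "\<rho> \<in> bounded_continuous k"
  define r where "r j = (if j = k then \<rho> else (\<lambda>_. 0))" for j
  have "(\<lambda>x. \<Sum>j\<in>{1..<n}. r j (proj_first j x) * (x (j + 1) - x j)) \<in> martingale_tests n"
    unfolding martingale_tests_def using \<rho> by (auto simp: r_def zero_bounded_continuous)
  moreover have "(\<Sum>j\<in>{1..<n}. r j (proj_first j x) * (x (j + 1) - x j)) =
      \<rho> (proj_first k x) * (x (k + 1) - x k)" for x
  proof -
    have "(\<Sum>j\<in>{1..<n}. r j (proj_first j x) * (x (j + 1) - x j)) =
        (\<Sum>j\<in>{1..<n}. if j = k then \<rho> (proj_first k x) * (x (k + 1) - x k) else 0)"
      by (intro sum.cong) (auto simp: r_def)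
    then show ?thesis
      using k by simp
  qed
  ultimately show "has_bochner_integral \<pi> (\<lambda>x. \<rho> (proj_first k x) * (x (k + 1) - x k)) 0"
    using tests by simp
next
  fix w assume steps: "\<forall>k\<in>{1..<n}. \<forall>\<rho>\<in>bounded_continuous k.
      has_bochner_integral \<pi> (\<lambda>x. \<rho> (proj_first k x) * (x (k + 1) - x k)) 0"
    and "w \<in> martingale_tests n"
  then obtain \<rho> where w: "w = (\<lambda>x. \<Sum>k\<in>{1..<n}. \<rho> k (proj_first k x) * (x (k + 1) - x k))"
    and \<rho>: "\<And>k. k \<in> {1..<n} \<Longrightarrow> \<rho> k \<in> bounded_continuous k"
    unfolding martingale_tests_def by blast
  have "has_bochner_integral \<pi> w (\<Sum>k\<in>{1..<n}. 0)"
    unfolding w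
  proof (rule has_bochner_integral_sum)
    fix k assume "k \<in> {1..<n}"
    then show "has_bochner_integral \<pi> (\<lambda>x. \<rho> k (proj_first k x) * (x (k + 1) - x k)) 0"
      using steps \<rho> by blast
  qed
  then show "has_bochner_integral \<pi> w 0"
    by simp
qed

theorem proposition4p2:
  fixes n :: nat and \<mu> :: "nat \<Rightarrow> real measure"
  assumes "n \<ge> 2"
    and "\<And>i. i \<in> {1..n} \<Longrightarrow> sets (\<mu> i) = sets borel"
    and "\<And>i. i \<in> {1..n} \<Longrightarrow> prob_space (\<mu> i)"
    and "\<And>i. i \<in> {1..n} \<Longrightarrow> integrable (\<mu> i) (\<lambda>t. t)"
  shows "constrained_couplings (martingale_tests n) n \<mu> =
    {\<pi> \<in> couplings n \<mu>. \<forall>k\<in>{1..<n}.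
       AE x in distr \<pi> (borel_Rn k) (proj_first k).
         has_bochner_integral (cond_distr \<pi> k x) (\<lambda>t. t) (x k)}"
  \<comment> \<open>Once the tests are separated by index, both sets are cut out of the same
    couplings by conditions that can be matched for each \<open>k\<close>.\<close>
  unfolding constrained_couplings_def martingale_tests_iff
proof (rule Collect_cong, rule conj_cong[OF refl], rule ball_cong[OF refl])
  fix \<pi> k assume "\<pi> \<in> couplings n \<mu>" "k \<in> {1..<n}"
  then show "(\<forall>\<rho>\<in>bounded_continuous k.
      has_bochner_integral \<pi> (\<lambda>x. \<rho> (proj_first k x) * (x (k + 1) - x k)) 0) \<longleftrightarrow>
    (AE x in distr \<pi> (borel_Rn k) (proj_first k).
      has_bochner_integral (cond_distr \<pi> k x) (\<lambda>t. t) (x k))"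
    using assms(4) by (rule martingale_step_iff)
qed

end
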